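(* Let $p$ be a pattern. Then $p$ is avoidable in the ordinary sense if and only if $p$ is avoidable up to $\simeq$.
   Context: For a word $x=x_1\cdots x_n$ (letters $x_i$), its reversal is $x^R=x_n\cdots x_1$. Let $\simeq$ be the equivalence relation on words with $x\simeq x'$ iff $x'=x$ or $x'=x^R$. A pattern is a word $p=p_1p_2\cdots p_n$ over an alphabet $V$ of variables. For an equivalence relation $\sim$ on words, a word $w$ encounters $p$ up to $\sim$ if $w$ has a factor $X_1X_2\cdots X_n$ where each $X_i$ is a nonempty word and $X_i\sim X_j$ whenever $p_i=p_j$; otherwise $w$ avoids $p$ up to $\sim$. The pattern $p$ is $k$-avoidable up to $\sim$ if some infinite word over a $k$-letter alphabet avoids $p$ up to $\sim$, and avoidable up to $\sim$ if it is $k$-avoidable up to $\sim$ for some $k$. Avoidable in the ordinary sense means avoidable up to equality $=$. *)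

theory Defs
  imports "HOL-Library.Omega_Words_Fun"
begin

definition rev_equiv :: "'a list \<Rightarrow> 'a list \<Rightarrow> bool"  (infix \<open>\<simeq>\<close> 50)
  where "x \<simeq> x' \<longleftrightarrow> x' = x \<or> x' = rev x"

lemma equivp_rev_equiv: "equivp (\<simeq>)"
  by (rule equivpI) (auto simp: rev_equiv_def reflp_def symp_def transp_def)

definition factor_of :: "'a list \<Rightarrow> 'a word \<Rightarrow> bool"
  where "factor_of u w \<longleftrightarrow> (\<exists>i j. i \<le> j \<and> u = w [i \<rightarrow> j])"

definition encounters :: "('a list \<Rightarrow> 'a list \<Rightarrow> bool) \<Rightarrow> 'a word \<Rightarrow> 'v list \<Rightarrow> bool"
  where "encounters R w p \<longleftrightarrow>
    (\<exists>Xs. length Xs = length p \<and> factor_of (concat Xs) w \<and>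
      (\<forall>i < length p. Xs ! i \<noteq> []) \<and>
      (\<forall>i < length p. \<forall>j < length p. p ! i = p ! j \<longrightarrow> R (Xs ! i) (Xs ! j)))"

abbreviation avoids :: "('a list \<Rightarrow> 'a list \<Rightarrow> bool) \<Rightarrow> 'a word \<Rightarrow> 'v list \<Rightarrow> bool"
  where "avoids R w p \<equiv> \<not> encounters R w p"

text \<open>Letters are drawn from \<^typ>\<open>nat\<close>, which contains a \<open>k\<close>-letter alphabet for every \<open>k\<close>.\<close>

definition k_avoidable :: "nat \<Rightarrow> (nat list \<Rightarrow> nat list \<Rightarrow> bool) \<Rightarrow> 'v list \<Rightarrow> bool"
  where "k_avoidable k R p \<longleftrightarrow>
    (\<exists>A w. finite A \<and> card A = k \<and> range w \<subseteq> A \<and> avoids R w p)"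

definition avoidable :: "(nat list \<Rightarrow> nat list \<Rightarrow> bool) \<Rightarrow> 'v list \<Rightarrow> bool"
  where "avoidable R p \<longleftrightarrow> (\<exists>k. k_avoidable k R p)"

end

theory Submission
  imports Defs
begin

text \<open>
  Equality refines \<open>\<simeq>\<close>, so a word avoiding \<open>p\<close> up to \<open>\<simeq>\<close> avoids \<open>p\<close>. Conversely, given a word \<open>w\<close>
  avoiding \<open>p\<close>, tag each letter with its position modulo 3. Along a factor of the tagged word the
  tag always increases by 1, so the reversal of a factor of length at least 2 is never a factor.
  On factors of the tagged word \<open>\<simeq>\<close> therefore coincides with equality, and erasing the tags turns
  an occurrence of \<open>p\<close> up to \<open>\<simeq>\<close> into an ordinary one in \<open>w\<close>.
\<close>

lemma encounters_mono:
  assumes "encounters R w p" and "\<And>x y. R x y \<Longrightarrow> S x y"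
  shows "encounters S w p"
  using assms(1) unfolding encounters_def by (blast intro: assms(2))

text \<open>The pair of letter and tag is packed into one \<open>nat\<close>: \<open>div 3\<close>
  recovers the letter, \<open>mod 3\<close> the tag.\<close>

definition mod3_tag :: "nat word \<Rightarrow> nat word"
  where "mod3_tag w n = 3 * w n + n mod 3"

abbreviation mod3_succ :: "nat \<Rightarrow> nat \<Rightarrow> bool"
  where "mod3_succ a b \<equiv> b mod 3 = Suc a mod 3"

lemma mod3_tag_div [simp]: "mod3_tag w n div 3 = w n"
  by (simp add: mod3_tag_def)

lemma mod3_succ_mod3_tag: "mod3_succ (mod3_tag w n) (mod3_tag w (Suc n))"
  by (simp add: mod3_tag_def mod_Suc)

lemma finite_range_mod3_tag:
  assumes "finite (range w)"
  shows "finite (range (mod3_tag w))"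
proof (rule finite_subset)
  show "range (mod3_tag w) \<subseteq> (\<lambda>(a, b). 3 * a + b) ` (range w \<times> {..<3})"
    by (force simp: mod3_tag_def)
qed (use assms in simp)

lemma successively_mod3_tag_factor:
  assumes "factor_of u (mod3_tag w)"
  shows "successively mod3_succ u"
  using assms
  by (auto simp: factor_of_def subsequence_def successively_conv_nth mod3_succ_mod3_tag)

lemma factor_of_untag:
  assumes "factor_of u (mod3_tag w)"
  shows "factor_of (map (\<lambda>a. a div 3) u) w"
proof -
  from assms obtain i j where "i \<le> j" "u = mod3_tag w [i \<rightarrow> j]"
    by (auto simp: factor_of_def)
  then have "map (\<lambda>a. a div 3) u = w [i \<rightarrow> j]"
    by (simp add: subsequence_def)
  with \<open>i \<le> j\<close> show ?thesis
    by (auto simp: factor_of_def)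
qed

text \<open>Neighbours within a block are still neighbours in the concatenation.\<close>

lemma successively_concatD:
  assumes "successively P (concat xss)" and "xs \<in> set xss"
  shows "successively P xs"
  using assms(2)[THEN split_list] assms(1) by (auto simp: successively_append_iff)

lemma rev_equiv_mod3_succ_imp_eq:
  assumes "x \<simeq> y" and "successively mod3_succ x" and "successively mod3_succ y"
  shows "x = y"
\<comment> \<open>Words of length at most 1 are their own reversal; only the case of two leading
  letters needs the tags.\<close>
proof (cases x rule: remdups_adj.cases)
  case (3 a b r)
  have "y \<noteq> rev x"
  proof
    assume "y = rev x"
    with assms 3 have "mod3_succ a b" "mod3_succ b a"
      by (simp_all only: successively_rev) simp_all
    \<comment> \<open>Together these give 2 = 0 modulo 3; tags modulo 2 would yield no
      contradiction.\<close>
    then show False by presburger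
  qed
  with assms(1) show ?thesis by (simp add: rev_equiv_def)
qed (use assms(1) in \<open>auto simp: rev_equiv_def\<close>)

lemma encounters_mod3_tag:
  assumes "encounters (\<simeq>) (mod3_tag w) p"
  shows "encounters (=) w p"
proof -
  from assms obtain Xs where Xs: "length Xs = length p" "factor_of (concat Xs) (mod3_tag w)"
    "\<And>i. i < length p \<Longrightarrow> Xs ! i \<noteq> []"
    "\<And>i j. i < length p \<Longrightarrow> j < length p \<Longrightarrow> p ! i = p ! j \<Longrightarrow> Xs ! i \<simeq> Xs ! j"
    unfolding encounters_def by blast
  have "successively mod3_succ (Xs ! i)" if "i < length p" for i
    using successively_concatD[OF successively_mod3_tag_factor[OF Xs(2)]] that Xs(1) by simp
  \<comment> \<open>This must precede erasing the tags, since \<open>w\<close> itself may contain a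
    factor along with its reversal.\<close>
  then have eq: "Xs ! i = Xs ! j" if "i < length p" "j < length p" "p ! i = p ! j" for i j
    using that Xs(4) rev_equiv_mod3_succ_imp_eq by blast
  define Ys where "Ys = map (map (\<lambda>a. a div 3)) Xs"
  have nth: "Ys ! i = map (\<lambda>a. a div 3) (Xs ! i)" if "i < length p" for i
    using that by (simp add: Ys_def Xs(1))
  have "length Ys = length p"
    by (simp add: Ys_def Xs(1))
  moreover have "factor_of (concat Ys) w"
    using factor_of_untag[OF Xs(2)] by (simp add: Ys_def map_concat)
  moreover have "Ys ! i \<noteq> []" if "i < length p" for i
    using that by (simp add: nth Xs(3))
  moreover have "Ys ! i = Ys ! j" if "i < length p" "j < length p" "p ! i = p ! j" for i j
    using eq[OF that] that by (simp only: nth)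
  ultimately show ?thesis
    unfolding encounters_def by blast
qed

text \<open>The range of \<open>w\<close> can itself serve as the alphabet, with \<open>k\<close>
  its cardinality.\<close>

lemma avoidable_iff_finite_range:
  "avoidable R p \<longleftrightarrow> (\<exists>w. finite (range w) \<and> avoids R w p)"
  unfolding avoidable_def k_avoidable_def by (auto intro: finite_subset)

theorem theorem2:
  fixes p :: "'v list"
  shows "avoidable (=) p \<longleftrightarrow> avoidable (\<simeq>) p"
proof
  assume "avoidable (=) p"
  then show "avoidable (\<simeq>) p"
    unfolding avoidable_iff_finite_range
    using finite_range_mod3_tag encounters_mod3_tag by blast
next
  assume "avoidable (\<simeq>) p"
  then show "avoidable (=) p"
    unfolding avoidable_iff_finite_range
    using encounters_mono[of "(=)" _ p "(\<simeq>)"] by (auto simp: rev_equiv_def)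
qed

end
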